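(* Let $n,m,r$ be positive integers, $X\in\mathbb{R}^{n\times m}_{\ge 0}$ and $Y\in\mathbb{R}^n$. Let $\lambda\ge 0$. Let $(W^{(\lambda)},H^{(\lambda)},\theta^{(\lambda)})$ be a global minimizer of the CSSNMF problem with weight $\lambda$ for the data $(X,Y)$, and let $(W^{(0)},H^{(0)},\theta^{(0)})$ be a global minimizer of the CSSNMF problem with weight $0$ for the same data, each assumed to be unique up to the rescaling equivalence (as defined in the context). Then $$R(W^{(\lambda)},\theta^{(\lambda)};Y)\le R(W^{(0)},\theta^{(0)};Y).$$
   Context: Fix positive integers $n,m,r$, a matrix $X\in\mathbb{R}^{n\times m}_{\ge 0}$ (entrywise nonnegative) and a vector $Y\in\mathbb{R}^n$. For $W\in\mathbb{R}^{n\times r}_{\ge 0}$, $H\in\mathbb{R}^{r\times m}_{\ge 0}$, $\theta\in\mathbb{R}^{r+1}$ define $$N(W,H;X)=\|X-WH\|_F^2,\qquad R(W,\theta;Y)=\|\bar W\theta-Y\|^2,$$ $$F^{(\lambda)}(W,H,\theta;X,Y)=N(W,H;X)+\lambda R(W,\theta;Y),$$ where $\|\cdot\|_F$ is the Frobenius norm, $\|\cdot\|$ is the Euclidean norm, and $\bar W\in\mathbb{R}^{n\times(r+1)}$ is the matrix obtained from $W$ by prepending a column of ones, i.e. $(\bar W\theta)_i=\theta_1+\sum_{k=1}^r W_{ik}\theta_{k+1}$. Feasible set: all triples $(W,H,\theta)$ with $W\in\mathbb{R}^{n\times r}_{\ge 0}$, $H\in\mathbb{R}^{r\times m}_{\ge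 0}$, $\theta\in\mathbb{R}^{r+1}$ satisfying the normalization $\sum_{j=1}^m H_{ij}=1$ for every $i=1,\dots,r$. Global minimizer of the CSSNMF problem with weight $\lambda$: - If $\lambda>0$: a feasible triple $(W^{(\lambda)},H^{(\lambda)},\theta^{(\lambda)})$ minimizing $F^{(\lambda)}(\cdot,\cdot,\cdot;X,Y)$ over all feasible triples. - If $\lambda=0$: a feasible triple $(W^{(0)},H^{(0)},\theta^{(0)})$ such that $(W^{(0)},H^{(0)})$ minimizes $N(W,H;X)$ over all $W\in\mathbb{R}^{n\times r}_{\ge 0}$ and $H\in\mathbb{R}^{r\times m}_{\ge 0}$ with row sums of $H$ equal to $1$, and then $\theta^{(0)}$ minimizes $R(W^{(0)},\theta;Y)$ over $\theta\in\mathbb{R}^{r+1}$. Uniqueness up to rescaling equivalence: a global minimizer $(W,H,\theta)$ (for a given weight) is called unique up to the rescaling equivalence if every global minimizer for that weight is of the form $(WS,\;S^{-1}H,\;(\theta_1,S^{-1}\theta_{2:(r+1)}))$ for some invertible $S\in\mathbb{R}^{r\times r}_{\ge 0}$ with $S^{-1}\in\mathbb{R}^{r\times r}_{\ge 0}$, where $\theta_{2:(r+1)}=(\theta_2,\dots,\theta_{r+1})^T$. *)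

theory Defs
  imports "HOL-Analysis.Analysis"
begin

text \<open>
  The sizes n, m, r are the cardinalities of the finite index types 'n, 'm, 'r (all positive, as
  types are nonempty), so a p-by-q matrix has type real^'q^'p. The r + 1 coordinates of the
  regression vector are indexed by 'r option: None is the first coordinate (the intercept) and
  Some k is the (k+1)-st.
\<close>

definition nonneg_mat :: "real^'q^'p \<Rightarrow> bool" where
  "nonneg_mat A \<longleftrightarrow> (\<forall>i j. 0 \<le> A $ i $ j)"

definition prepend_ones :: "real^'r^'n \<Rightarrow> real^('r option)^'n" where
  "prepend_ones W = (\<chi> i k. case k of None \<Rightarrow> 1 | Some j \<Rightarrow> W $ i $ j)"

definition tail_vec :: "real^('r option) \<Rightarrow> real^'r" where
  "tail_vec \<theta> = (\<chi> k. \<theta> $ Some k)"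

definition cons_vec :: "real \<Rightarrow> real^'r \<Rightarrow> real^('r option)" where
  "cons_vec a v = (\<chi> k. case k of None \<Rightarrow> a | Some j \<Rightarrow> v $ j)"

text \<open>
  On the type real^'q^'p the library norm is the Euclidean norm of the vector of row norms,
  that is, the Frobenius norm.
\<close>

lemma norm_matrix_power2:
  fixes A :: "real^'q^'p"
  shows "(norm A)\<^sup>2 = (\<Sum>i\<in>UNIV. \<Sum>j\<in>UNIV. (A $ i $ j)\<^sup>2)"
  by (simp add: norm_vec_def L2_set_def sum_nonneg)

definition nmf_error :: "real^'m^'n \<Rightarrow> real^'r^'n \<Rightarrow> real^'m^'r \<Rightarrow> real" where
  "nmf_error X W H = (norm (X - W ** H))\<^sup>2"

definition regr_error :: "real^'n \<Rightarrow> real^'r^'n \<Rightarrow> real^('r option) \<Rightarrow> real" where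
  "regr_error Y W \<theta> = (norm (prepend_ones W *v \<theta> - Y))\<^sup>2"

lemma prepend_ones_mult_vec:
  "(prepend_ones W *v \<theta>) $ i = \<theta> $ None + (\<Sum>k\<in>UNIV. W $ i $ k * \<theta> $ Some k)"
  by (simp add: prepend_ones_def matrix_vector_mult_def UNIV_option_conv sum.reindex)

definition cssnmf_objective ::
  "real \<Rightarrow> real^'m^'n \<Rightarrow> real^'n \<Rightarrow> real^'r^'n \<Rightarrow> real^'m^'r \<Rightarrow> real^('r option) \<Rightarrow> real" where
  "cssnmf_objective lam X Y W H \<theta> = nmf_error X W H + lam * regr_error Y W \<theta>"

text \<open>The regression vector is unconstrained, so feasibility only concerns W and H.\<close>

definition feasible :: "real^'r^'n \<Rightarrow> real^'m^'r \<Rightarrow> bool" where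
  "feasible W H \<longleftrightarrow> nonneg_mat W \<and> nonneg_mat H \<and> (\<forall>i. (\<Sum>j\<in>UNIV. H $ i $ j) = 1)"

text \<open>
  For weight 0 the problem is the sequential one (factorization first, regression second), not
  the minimization of the objective at weight 0. There are no minimizers for negative weights.
\<close>

definition global_minimizer ::
  "real \<Rightarrow> real^'m^'n \<Rightarrow> real^'n \<Rightarrow> real^'r^'n \<Rightarrow> real^'m^'r \<Rightarrow> real^('r option) \<Rightarrow> bool" where
  "global_minimizer lam X Y W H \<theta> \<longleftrightarrow>
     feasible W H \<and>
     (0 < lam \<and>
        (\<forall>(W' :: real^'r^'n) H' \<theta>'. feasible W' H' \<longrightarrow>
           cssnmf_objective lam X Y W H \<theta> \<le> cssnmf_objective lam X Y W' H' \<theta>')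
      \<or> lam = 0 \<and>
        (\<forall>(W' :: real^'r^'n) H'. feasible W' H' \<longrightarrow> nmf_error X W H \<le> nmf_error X W' H') \<and>
        (\<forall>\<theta>'. regr_error Y W \<theta> \<le> regr_error Y W \<theta>'))"

definition unique_upto_rescaling ::
  "real \<Rightarrow> real^'m^'n \<Rightarrow> real^'n \<Rightarrow> real^'r^'n \<Rightarrow> real^'m^'r \<Rightarrow> real^('r option) \<Rightarrow> bool" where
  "unique_upto_rescaling lam X Y W H \<theta> \<longleftrightarrow>
     (\<forall>W' H' \<theta>'. global_minimizer lam X Y W' H' \<theta>' \<longrightarrow>
        (\<exists>S :: real^'r^'r. invertible S \<and> nonneg_mat S \<and> nonneg_mat (matrix_inv S) \<and>
           W' = W ** S \<and> H' = matrix_inv S ** H \<and>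
           \<theta>' = cons_vec (\<theta> $ None) (matrix_inv S *v tail_vec \<theta>)))"

end

theory Submission
  imports Defs
begin

text \<open>
  For positive weight, compare the objective at the two minimizers: the sequential solution has
  the smaller factorization error, so it must have the larger regression error. At weight 0 this
  comparison is void, since optimal factorizations need not share their regression error; here
  uniqueness enters, because rescaling leaves the prediction unchanged.
\<close>

text \<open>The column of ones meets only the intercept, which rescaling fixes; in the remaining
  product \<open>S\<close> cancels against its inverse.\<close>

lemma prepend_ones_mult_rescale:
  fixes W :: "real^'r^'n" and S :: "real^'r^'r"
  assumes "invertible S"
  shows "prepend_ones (W ** S) *v cons_vec (\<theta> $ None) (matrix_inv S *v tail_vec \<theta>)
           = prepend_ones W *v \<theta>"
proof -
  have split: "prepend_ones V *v \<eta> = (\<chi> i. \<eta> $ None) + V *v tail_vec \<eta>"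
    for V :: "real^'r^'n" and \<eta>
    by (simp add: vec_eq_iff prepend_ones_mult_vec)
       (simp add: matrix_vector_mult_def tail_vec_def)
  \<comment> \<open>\<open>matrix_inv\<close> is a Hilbert choice, so its defining property needs
    the witness from invertibility.\<close>
  have "S ** matrix_inv S = mat 1"
    using assms unfolding invertible_def matrix_inv_def by (rule someI2_ex) blast
  then have "(W ** S) *v (matrix_inv S *v v) = W *v v" for v
    by (metis matrix_mul_assoc matrix_mul_rid matrix_vector_mul_assoc)
  moreover have "tail_vec (cons_vec a v) = v" "cons_vec a v $ None = a" for a and v :: "real^'r"
    by (simp_all add: tail_vec_def cons_vec_def)
  ultimately show ?thesis
    by (simp add: split)
qed

theorem proposition1:
  fixes X :: "real^'m^'n" and Y :: "real^'n" and lam :: real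
    and W W\<^sub>0 :: "real^'r^'n" and H H\<^sub>0 :: "real^'m^'r"
    and \<theta> \<theta>\<^sub>0 :: "real^('r option)"
  assumes "nonneg_mat X"
    and "0 \<le> lam"
    and "global_minimizer lam X Y W H \<theta>"
    and "unique_upto_rescaling lam X Y W H \<theta>"
    and "global_minimizer 0 X Y W\<^sub>0 H\<^sub>0 \<theta>\<^sub>0"
    and "unique_upto_rescaling 0 X Y W\<^sub>0 H\<^sub>0 \<theta>\<^sub>0"
  shows "regr_error Y W \<theta> \<le> regr_error Y W\<^sub>0 \<theta>\<^sub>0"
proof (cases "lam = 0")
  case True
  then obtain S :: "real^'r^'r" where "invertible S" "W = W\<^sub>0 ** S"
    "\<theta> = cons_vec (\<theta>\<^sub>0 $ None) (matrix_inv S *v tail_vec \<theta>\<^sub>0)"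
    using assms(3,6) unfolding unique_upto_rescaling_def by blast
  then show ?thesis
    by (simp add: regr_error_def prepend_ones_mult_rescale)
next
  case False
  with assms(2) have "0 < lam" by simp
  have "nmf_error X W H + lam * regr_error Y W \<theta>
      \<le> nmf_error X W\<^sub>0 H\<^sub>0 + lam * regr_error Y W\<^sub>0 \<theta>\<^sub>0"
    using assms(3,5) False by (auto simp: global_minimizer_def cssnmf_objective_def)
  \<comment> \<open>Feasibility does not depend on the weight, so \<open>W\<close> and
    \<open>H\<close> compete in the weight-0 factorization.\<close>
  moreover have "nmf_error X W\<^sub>0 H\<^sub>0 \<le> nmf_error X W H"
    using assms(3,5) by (auto simp: global_minimizer_def)
  ultimately have "lam * regr_error Y W \<theta> \<le> lam * regr_error Y W\<^sub>0 \<theta>\<^sub>0"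
    by linarith
  with \<open>0 < lam\<close> show ?thesis by simp
qed

end
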